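(* For every grid $\theta\in\Theta$ and every real $q$, the box sums $\Psi_\tau$ generate the generalized return time dimensions $D^\pm_\tau(q)$. That is, for $q\neq 1$, $$D^+_\tau(q)=\limsup_{\varepsilon\to0}\frac{1}{q-1}\frac{\log \Psi_\tau(\theta,\varepsilon,q)}{\log\varepsilon},\qquad D^-_\tau(q)=\liminf_{\varepsilon\to0}\frac{1}{q-1}\frac{\log \Psi_\tau(\theta,\varepsilon,q)}{\log\varepsilon},$$ and for $q=1$, $$D^+_\tau(1)=\limsup_{\varepsilon\to0}\frac{\Psi^l_\tau(\theta,\varepsilon)}{\log\varepsilon},\qquad D^-_\tau(1)=\liminf_{\varepsilon\to0}\frac{\Psi^l_\tau(\theta,\varepsilon)}{\log\varepsilon}.$$
   Context: Setting: $X\subset\mathbb{R}^n$ is a compact metric space (Euclidean distance), $T:X\to X$ is a map preserving a probability measure $\mu$ on a suitable sigma-algebra $\mathcal{A}$ of subsets of $X$ (containing balls and boxes), and $(X,T,\mathcal{A},\mu)$ is ergodic. $B_\varepsilon(x)$ is the ball of radius $\varepsilon$ centered at $x$. For $A\in\mathcal{A}$ and $x\in A$, $\tau_A(x)=\inf\{m>0:\ T^m(x)\in A\}$ is the first return time of $x$ to $A$. Generalized return time dimensions: for $q\ne1$ let $\Gamma_\tau(\varepsilon,q)=\int_X[\tau_{B_\varepsilon(x)}(x)]^{1-q}\,d\mu(x)$, and let $\Gamma^l_\tau(\varepsilon)=\int_X\log[\tau^{-1}_{B_\varepsilon(x)}(x)]\,d\mu(x)$. For $q\neq1$, $D^+_\tau(q)$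 and $D^-_\tau(q)$ are respectively the limsup and liminf, as $\varepsilon\to0$, of $\frac{1}{q-1}\frac{\log\Gamma_\tau(\varepsilon,q)}{\log\varepsilon}$; for $q=1$ they are the limsup and liminf of $\Gamma^l_\tau(\varepsilon)/\log\varepsilon$. If an integrand is not summable the partition function has the value $+\infty$, and the corresponding dimension is set to $+\infty$ (same convention for $\Psi_\tau$). Grids: a grid $\theta$ is a choice of an origin and an orthonormal orientation in $\mathbb{R}^n$; $\Theta$ is the set of all grids. For each $\varepsilon>0$, $\theta$ determines the lattice partition into hypercubic (half-open) boxes $A_j$, $j=0,1,\dots$, of side $\varepsilon$, with the origin of $\theta$ as a box corner and sides along the directions of $\theta$ (the dependence of $A_j$ on $\theta,\varepsilon$ is implicit). $\overline{A}_j$ denotes the box of side $3\varepsilon$ with the same center and orientation as $A_j$. Boxes are understood intersected with $X$. Box sums: $\Psi_\tau(\theta,\varepsilon,q)=\sum_j\int_{A_j}\tau_{\overline{A}_j}^{1-q}(x)\,d\mu(x)$ for $q\ne1$, and $\Psi^l_\tau(\theta,\varepsilon)=\sum_j\int_{A_j}\log(\tau^{-1}_{\overline{A}_j}(x))\,d\mu(x)$ (integration over $A_j$, return time to the larger box $\overline{A}_j$). *)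

theory Defs
  imports "HOL-Probability.Probability"
begin

section \<open>Extended-real arithmetic and integration\<close>

text \<open>Return times take values in \<open>[1,\<infinity>]\<close>, so powers and logarithms are continued to the infinite
  values by their limits: \<open>\<infinity>\<close> to a positive (negative) power is \<open>\<infinity>\<close> (0), \<open>log 0 = -\<infinity>\<close> and
  \<open>log \<infinity> = \<infinity>\<close>. Negative arguments never occur.\<close>

definition ereal_powr :: "ereal \<Rightarrow> real \<Rightarrow> ereal" where
  "ereal_powr x s =
     (if x = \<infinity> then (if s > 0 then \<infinity> else if s = 0 then 1 else 0)
      else ereal (real_of_ereal x powr s))"

definition ereal_log :: "ereal \<Rightarrow> ereal" where
  "ereal_log x =
     (if x = \<infinity> then \<infinity> else if x \<le> 0 then -\<infinity> else ereal (ln (real_of_ereal x)))"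

text \<open>The Lebesgue integral of an extended-real function, with the convention that it is \<open>+\<infinity>\<close>
  whenever the function is not summable (even if its negative part is the one that diverges).
  The cutoff \<open>e2ennreal\<close> sends negative numbers to 0, so the two integrals are those of the
  positive and the negative part.\<close>

definition ext_integral :: "'a measure \<Rightarrow> ('a \<Rightarrow> ereal) \<Rightarrow> ereal" where
  "ext_integral M f =
     (let P = \<integral>\<^sup>+x. e2ennreal (f x) \<partial>M; N = \<integral>\<^sup>+x. e2ennreal (- f x) \<partial>M
      in if P = \<infinity> \<or> N = \<infinity> then \<infinity> else enn2ereal P - enn2ereal N)"

definition set_ext_integral :: "'a measure \<Rightarrow> 'a set \<Rightarrow> ('a \<Rightarrow> ereal) \<Rightarrow> ereal" where
  "set_ext_integral M A f = ext_integral M (\<lambda>x. f x * indicator A x)"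


section \<open>Dynamics\<close>

definition measure_preserving_map :: "'a measure \<Rightarrow> ('a \<Rightarrow> 'a) \<Rightarrow> bool" where
  "measure_preserving_map M T \<longleftrightarrow> T \<in> measurable M M \<and> distr M M T = M"

definition ergodic_map :: "'a measure \<Rightarrow> ('a \<Rightarrow> 'a) \<Rightarrow> bool" where
  "ergodic_map M T \<longleftrightarrow> measure_preserving_map M T \<and>
     (\<forall>A\<in>sets M. T -` A \<inter> space M = A \<longrightarrow> measure M A = 0 \<or> measure M A = 1)"

text \<open>The infimum is \<open>\<infinity>\<close> if the orbit never returns.\<close>

definition return_time :: "('a \<Rightarrow> 'a) \<Rightarrow> 'a set \<Rightarrow> 'a \<Rightarrow> ereal" where
  "return_time T A x = (INF m\<in>{m::nat. 0 < m \<and> (T ^^ m) x \<in> A}. ereal (real m))"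


section \<open>Generalized return time dimensions\<close>

definition Gamma_tau :: "'a::metric_space measure \<Rightarrow> ('a \<Rightarrow> 'a) \<Rightarrow> real \<Rightarrow> real \<Rightarrow> ereal" where
  "Gamma_tau M T \<epsilon> q =
     ext_integral M (\<lambda>x. ereal_powr (return_time T (ball x \<epsilon> \<inter> space M) x) (1 - q))"

definition Gamma_log_tau :: "'a::metric_space measure \<Rightarrow> ('a \<Rightarrow> 'a) \<Rightarrow> real \<Rightarrow> ereal" where
  "Gamma_log_tau M T \<epsilon> =
     ext_integral M (\<lambda>x. ereal_log (inverse (return_time T (ball x \<epsilon> \<inter> space M) x)))"

text \<open>Scaling quotients of the value \<open>P\<close> of a partition function at scale \<open>\<epsilon>\<close>, for exponents
  \<open>q \<noteq> 1\<close> and \<open>q = 1\<close> respectively. A partition function equal to \<open>+\<infinity>\<close> signals a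
  non-summable integrand and makes the quotient \<open>+\<infinity>\<close>. Return times grow as \<open>\<epsilon>\<close> shrinks, so
  non-summability at one scale persists at all sufficiently small ones and the corresponding
  dimension is then \<open>+\<infinity>\<close>.\<close>

definition dim_quotient :: "real \<Rightarrow> ereal \<Rightarrow> real \<Rightarrow> ereal" where
  "dim_quotient q P \<epsilon> =
     (if P = \<infinity> then \<infinity> else ereal (1 / (q - 1)) * (ereal_log P / ereal (ln \<epsilon>)))"

definition log_dim_quotient :: "ereal \<Rightarrow> real \<Rightarrow> ereal" where
  "log_dim_quotient P \<epsilon> = (if P = \<infinity> then \<infinity> else P / ereal (ln \<epsilon>))"

definition upper_return_dim :: "'a::metric_space measure \<Rightarrow> ('a \<Rightarrow> 'a) \<Rightarrow> real \<Rightarrow> ereal" where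
  "upper_return_dim M T q =
     (if q = 1 then Limsup (at_right 0) (\<lambda>\<epsilon>. log_dim_quotient (Gamma_log_tau M T \<epsilon>) \<epsilon>)
      else Limsup (at_right 0) (\<lambda>\<epsilon>. dim_quotient q (Gamma_tau M T \<epsilon> q) \<epsilon>))"

definition lower_return_dim :: "'a::metric_space measure \<Rightarrow> ('a \<Rightarrow> 'a) \<Rightarrow> real \<Rightarrow> ereal" where
  "lower_return_dim M T q =
     (if q = 1 then Liminf (at_right 0) (\<lambda>\<epsilon>. log_dim_quotient (Gamma_log_tau M T \<epsilon>) \<epsilon>)
      else Liminf (at_right 0) (\<lambda>\<epsilon>. dim_quotient q (Gamma_tau M T \<epsilon> q) \<epsilon>))"


section \<open>Grids and box sums\<close>

text \<open>A grid is an origin together with an orthogonal matrix whose rows are the directions of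
  the axes, so \<open>Q *v (x - p)\<close> is the coordinate vector of \<open>x\<close> in the grid \<open>(p, Q)\<close>.\<close>

type_synonym 'n grid = "(real ^ 'n) \<times> (real ^ 'n ^ 'n)"

definition grids :: "('n::finite) grid set" where
  "grids = {(p, Q). orthogonal_matrix Q}"

definition cube :: "real ^ 'n ^ 'n \<Rightarrow> real ^ 'n \<Rightarrow> real \<Rightarrow> (real ^ 'n::finite) set" where
  "cube Q c s = {x. \<forall>i. - s / 2 \<le> (Q *v (x - c)) $ i \<and> (Q *v (x - c)) $ i < s / 2}"

text \<open>The boxes of the lattice partition are indexed by integer vectors \<open>k\<close> instead of
  \<open>j = 0, 1, \<dots>\<close>: the box with index \<open>k\<close> is the product of the intervals
  \<open>[\<epsilon> k\<^sub>i, \<epsilon> (k\<^sub>i + 1))\<close> in grid coordinates.\<close>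

definition box_center :: "('n::finite) grid \<Rightarrow> real \<Rightarrow> int ^ 'n \<Rightarrow> real ^ 'n" where
  "box_center \<theta> \<epsilon> k =
     fst \<theta> + transpose (snd \<theta>) *v (\<chi> i. \<epsilon> * (of_int (k $ i) + 1 / 2))"

definition grid_box :: "('n::finite) grid \<Rightarrow> real \<Rightarrow> int ^ 'n \<Rightarrow> (real ^ 'n) set" where
  "grid_box \<theta> \<epsilon> k = cube (snd \<theta>) (box_center \<theta> \<epsilon> k) \<epsilon>"

definition enlarged_box :: "('n::finite) grid \<Rightarrow> real \<Rightarrow> int ^ 'n \<Rightarrow> (real ^ 'n) set" where
  "enlarged_box \<theta> \<epsilon> k = cube (snd \<theta>) (box_center \<theta> \<epsilon> k) (3 * \<epsilon>)"

text \<open>If the space is bounded, only finitely many boxes meet it, so all but finitely many of the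
  summands below vanish and the sums are finite sums in disguise. No summand is ever \<open>-\<infinity>\<close>.\<close>

definition Psi_tau ::
    "(real ^ 'n) measure \<Rightarrow> (real ^ 'n \<Rightarrow> real ^ 'n) \<Rightarrow> ('n::finite) grid \<Rightarrow> real \<Rightarrow> real \<Rightarrow> ereal" where
  "Psi_tau M T \<theta> \<epsilon> q =
     infsum (\<lambda>k. set_ext_integral M (grid_box \<theta> \<epsilon> k \<inter> space M)
       (\<lambda>x. ereal_powr (return_time T (enlarged_box \<theta> \<epsilon> k \<inter> space M) x) (1 - q))) UNIV"

definition Psi_log_tau ::
    "(real ^ 'n) measure \<Rightarrow> (real ^ 'n \<Rightarrow> real ^ 'n) \<Rightarrow> ('n::finite) grid \<Rightarrow> real \<Rightarrow> ereal" where
  "Psi_log_tau M T \<theta> \<epsilon> =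
     infsum (\<lambda>k. set_ext_integral M (grid_box \<theta> \<epsilon> k \<inter> space M)
       (\<lambda>x. ereal_log (inverse (return_time T (enlarged_box \<theta> \<epsilon> k \<inter> space M) x)))) UNIV"

end

theory Submission
  imports Defs
begin

text \<open>If \<open>x\<close> lies in the box \<open>A\<close> of side \<open>\<epsilon>\<close>, the enlarged box contains the ball of radius \<open>\<epsilon>\<close>
  around \<open>x\<close> and is contained in the ball of radius \<open>2 n \<epsilon>\<close>. So the return time of \<open>x\<close> to the enlarged
  box lies between its return times to these two balls, and the box sum, being the integral of a
  monotone function of that return time, lies between the partition functions at the scales
  \<open>\<epsilon>\<close> and \<open>2 n \<epsilon>\<close>. A constant factor in the scale does not affect the logarithmic quotients in
  the limit. All bounds hold in the extended reals, so infinite integrals and return times need no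
  separate treatment.\<close>

section \<open>Extended-real arithmetic and integration\<close>

lemma ereal_log_mono: "x \<le> y \<Longrightarrow> ereal_log x \<le> ereal_log y"
  by (cases x; cases y) (auto simp: ereal_log_def)

lemma ereal_log_nonneg: "1 \<le> x \<Longrightarrow> 0 \<le> ereal_log x"
  by (cases x) (auto simp: ereal_log_def)

lemma ereal_log_nonpos: "x \<le> 1 \<Longrightarrow> ereal_log x \<le> 0"
  by (cases x) (auto simp: ereal_log_def)

lemma ereal_log_inverse_nonpos: "1 \<le> x \<Longrightarrow> ereal_log (inverse x) \<le> 0"
  by (cases x) (auto simp: ereal_log_def inverse_le_1_iff)

lemma ereal_log_inverse_antimono: "1 \<le> x \<Longrightarrow> x \<le> y \<Longrightarrow> ereal_log (inverse y) \<le> ereal_log (inverse x)"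
  by (cases x; cases y) (auto simp: ereal_log_def)

lemma ereal_powr_nonneg: "0 \<le> ereal_powr x s"
  by (auto simp: ereal_powr_def)

lemma ereal_powr_mono:
  assumes "0 < s" "1 \<le> x" "x \<le> y"
  shows "ereal_powr x s \<le> ereal_powr y s"
  using assms by (cases x; cases y) (auto simp: ereal_powr_def intro!: powr_mono2)

lemma ereal_powr_antimono:
  assumes "s < 0" "1 \<le> x" "x \<le> y"
  shows "ereal_powr y s \<le> ereal_powr x s"
  using assms by (cases x; cases y) (auto simp: ereal_powr_def intro!: powr_mono2')

lemma ereal_powr_one: "ereal_powr 1 s = 1"
  by (simp add: ereal_powr_def one_ereal_def)

lemma ereal_powr_ge_one:
  assumes "0 < s" "1 \<le> x"
  shows "1 \<le> ereal_powr x s"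
  using ereal_powr_mono[OF assms(1) order_refl assms(2)] by (simp add: ereal_powr_one)

lemma ereal_powr_le_one:
  assumes "s < 0" "1 \<le> x"
  shows "ereal_powr x s \<le> 1"
  using ereal_powr_antimono[OF assms(1) order_refl assms(2)] by (simp add: ereal_powr_one)

lemma borel_measurable_ereal_powr: "(\<lambda>x. ereal_powr x s) \<in> borel_measurable borel"
  unfolding ereal_powr_def by measurable

lemma borel_measurable_ereal_log: "ereal_log \<in> borel_measurable borel"
  unfolding ereal_log_def by measurable

section \<open>Additivity of the extended integral over a finite partition\<close>

lemma e2ennreal_sum_indicator_disjoint:
  assumes "finite K" "disjoint_family_on A K" "j \<in> K" "x \<in> A j"
  shows "(\<Sum>k\<in>K. e2ennreal (f k x * indicator (A k) x)) = e2ennreal (f j x)"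
proof -
  have "(\<Sum>k\<in>K. e2ennreal (f k x * indicator (A k) x)) =
      (\<Sum>k\<in>K. if k = j then e2ennreal (f j x) else 0)"
  proof (rule sum.cong)
    fix k assume k: "k \<in> K"
    have "x \<notin> A k" if "k \<noteq> j"
      using assms that k by (auto simp: disjoint_family_on_def)
    then show "e2ennreal (f k x * indicator (A k) x) = (if k = j then e2ennreal (f j x) else 0)"
      using assms by auto
  qed simp
  then show ?thesis
    using assms by simp
qed

text \<open>The integrals of the positive and of the negative parts are each additive over the
  pieces. The convention for non-summable functions is compatible with this: the whole is
  non-summable exactly if some piece is, and no piece ever contributes
  \<open>-\<infinity>\<close>.\<close>

lemma sum_set_ext_integral:
  assumes K: "finite K" "disjoint_family_on A K" "space M = (\<Union>k\<in>K. A k)"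
    and A: "\<And>k. k \<in> K \<Longrightarrow> A k \<in> sets M"
    and f: "\<And>k. k \<in> K \<Longrightarrow> f k \<in> borel_measurable M"
    and g: "\<And>k x. k \<in> K \<Longrightarrow> x \<in> A k \<Longrightarrow> g x = f k x"
  shows "(\<Sum>k\<in>K. set_ext_integral M (A k) (f k)) = ext_integral M g"
proof -
  define P where "P k = (\<integral>\<^sup>+x. e2ennreal (f k x * indicator (A k) x) \<partial>M)" for k
  define N where "N k = (\<integral>\<^sup>+x. e2ennreal (- f k x * indicator (A k) x) \<partial>M)" for k
  have meas: "(\<lambda>x. e2ennreal (f k x * indicator (A k) x)) \<in> borel_measurable M"
    "(\<lambda>x. e2ennreal (- f k x * indicator (A k) x)) \<in> borel_measurable M" if "k \<in> K" for k
    using A[OF that] f[OF that] by measurable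
  have "(\<integral>\<^sup>+x. e2ennreal (g x) \<partial>M) =
      (\<integral>\<^sup>+x. (\<Sum>k\<in>K. e2ennreal (f k x * indicator (A k) x)) \<partial>M)"
    using K(3) g e2ennreal_sum_indicator_disjoint[OF K(1,2)]
    by (intro nn_integral_cong) auto
  also have "\<dots> = sum P K"
    unfolding P_def by (intro nn_integral_sum meas)
  finally have P: "(\<integral>\<^sup>+x. e2ennreal (g x) \<partial>M) = sum P K" .
  have "(\<integral>\<^sup>+x. e2ennreal (- g x) \<partial>M) =
      (\<integral>\<^sup>+x. (\<Sum>k\<in>K. e2ennreal (- f k x * indicator (A k) x)) \<partial>M)"
    using K(3) g e2ennreal_sum_indicator_disjoint[OF K(1,2), where f = "\<lambda>k x. - f k x"]
    by (intro nn_integral_cong) auto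
  also have "\<dots> = sum N K"
    unfolding N_def by (intro nn_integral_sum meas)
  finally have N: "(\<integral>\<^sup>+x. e2ennreal (- g x) \<partial>M) = sum N K" .
  have S: "set_ext_integral M (A k) (f k) =
      (if P k = \<infinity> \<or> N k = \<infinity> then \<infinity> else enn2ereal (P k) - enn2ereal (N k))" for k
    by (simp add: set_ext_integral_def ext_integral_def P_def N_def Let_def)
  show ?thesis
  proof (cases "\<exists>k\<in>K. P k = \<infinity> \<or> N k = \<infinity>")
    case True
    then have "(\<Sum>k\<in>K. set_ext_integral M (A k) (f k)) = \<infinity>"
      using K(1) by (auto simp: sum_Pinfty S)
    moreover have "sum P K = \<infinity> \<or> sum N K = \<infinity>"
    proof -
      obtain k where k: "k \<in> K" "P k = \<infinity> \<or> N k = \<infinity>"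
        using True by blast
      have "P k \<le> sum P K" "N k \<le> sum N K"
        using k K(1) by (auto intro: member_le_sum)
      then show ?thesis
        using k by (auto simp: top_unique)
    qed
    ultimately show ?thesis
      unfolding ext_integral_def by (auto simp: P N Let_def)
  next
    \<comment> \<open>All parts are finite here, so they can be replaced by reals, where sums and
      differences may be interchanged freely.\<close>
    case False
    then have fin: "P k = ennreal (enn2real (P k))" "N k = ennreal (enn2real (N k))" if "k \<in> K" for k
      using that by (auto simp: less_top)
    define p where "p k = enn2real (P k)" for k
    define n where "n k = enn2real (N k)" for k
    have p: "P k = ennreal (p k)" "0 \<le> p k" and n: "N k = ennreal (n k)" "0 \<le> n k" if "k \<in> K" for k
      using fin[OF that] by (auto simp: p_def n_def)
    have "(\<Sum>k\<in>K. set_ext_integral M (A k) (f k)) = (\<Sum>k\<in>K. ereal (p k - n k))"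
      by (intro sum.cong) (auto simp: S p n enn2ereal_ennreal)
    also have "\<dots> = ereal (sum p K) - ereal (sum n K)"
      by (simp add: sum_subtractf)
    finally have "(\<Sum>k\<in>K. set_ext_integral M (A k) (f k)) = ereal (sum p K) - ereal (sum n K)" .
    moreover have "sum P K = ennreal (sum p K)" "sum N K = ennreal (sum n K)"
      by (simp_all add: p n cong: sum.cong)
    ultimately show ?thesis
      unfolding ext_integral_def
      using p n by (simp add: P N Let_def enn2ereal_ennreal sum_nonneg)
  qed
qed

section \<open>Extended integrals of nonnegative functions\<close>

lemma ext_integral_nonneg_eq:
  assumes "\<And>x. x \<in> space M \<Longrightarrow> 0 \<le> f x"
  shows "ext_integral M f = enn2ereal (\<integral>\<^sup>+x. e2ennreal (f x) \<partial>M)"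
proof -
  have "(\<integral>\<^sup>+x. e2ennreal (- f x) \<partial>M) = (\<integral>\<^sup>+x. 0 \<partial>M)"
    using assms by (intro nn_integral_cong e2ennreal_neg) auto
  then show ?thesis
    by (auto simp: ext_integral_def Let_def zero_ennreal.rep_eq)
qed

text \<open>The nonnegative integral is monotone for arbitrary functions. This makes the comparison
  applicable to return times to a ball centered at the moving point \<open>x\<close>, whose
  measurability is not established here.\<close>

lemma ext_integral_mono_nonneg:
  assumes "\<And>x. x \<in> space M \<Longrightarrow> 0 \<le> f x" "\<And>x. x \<in> space M \<Longrightarrow> f x \<le> g x"
  shows "ext_integral M f \<le> ext_integral M g"
proof -
  have "0 \<le> g x" if "x \<in> space M" for x
    using assms(1,2)[OF that] by order
  then show ?thesis
    using assms
    by (simp add: ext_integral_nonneg_eq less_eq_ennreal.rep_eq[symmetric]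
        e2ennreal_mono nn_integral_mono)
qed

lemma (in prob_space) ext_integral_const_one: "ext_integral M (\<lambda>_. 1) = 1"
  by (simp add: ext_integral_nonneg_eq emeasure_space_1 enn2ereal_e2ennreal)

section \<open>Scaling quotients\<close>

text \<open>The signs of the integral and of \<open>ln \<epsilon>\<close> cancel. If the integrand
  is not summable, both sides are \<open>\<infinity>\<close>, the left one by convention.\<close>

lemma log_dim_quotient_ext_integral_nonpos:
  assumes "\<And>x. x \<in> space M \<Longrightarrow> f x \<le> 0" "0 < \<epsilon>" "\<epsilon> < 1"
  shows "log_dim_quotient (ext_integral M f) \<epsilon> = ext_integral M (\<lambda>x. - f x) / ereal (- ln \<epsilon>)"
proof -
  define N where "N = (\<integral>\<^sup>+x. e2ennreal (- f x) \<partial>M)"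
  have "(\<integral>\<^sup>+x. e2ennreal (f x) \<partial>M) = (\<integral>\<^sup>+x. 0 \<partial>M)"
    using assms by (intro nn_integral_cong e2ennreal_neg) auto
  then have 1: "ext_integral M f = (if N = \<infinity> then \<infinity> else - enn2ereal N)"
    by (simp add: ext_integral_def N_def zero_ennreal.rep_eq)
  have 2: "ext_integral M (\<lambda>x. - f x) = enn2ereal N"
    using assms by (simp add: ext_integral_nonneg_eq N_def)
  show ?thesis
    unfolding 1 2 log_dim_quotient_def
    using assms by (cases N) (auto simp: enn2ereal_ennreal)
qed

text \<open>For \<open>q > 1\<close> and \<open>P = \<infinity>\<close> the convention gives
  \<open>\<infinity>\<close> on the left, while the right side would be \<open>-\<infinity>\<close>;
  the first assumption excludes this case.\<close>

lemma dim_quotient_eq: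
  assumes "q < 1 \<or> P \<noteq> \<infinity>" "q \<noteq> 1" "0 < \<epsilon>" "\<epsilon> < 1"
  shows "dim_quotient q P \<epsilon> = ereal (1 / (1 - q)) * ereal_log P / ereal (- ln \<epsilon>)"
proof -
  have l: "ln \<epsilon> < 0"
    using assms by simp
  show ?thesis
  proof (cases "ereal_log P")
    case (real r)
    then have "P \<noteq> \<infinity>" by (auto simp: ereal_log_def)
    with real l assms show ?thesis
      by (auto simp: dim_quotient_def field_simps)
  next
    case PInf
    then have "P = \<infinity>" by (auto simp: ereal_log_def split: if_splits)
    with PInf l assms show ?thesis
      by (auto simp: dim_quotient_def)
  next
    case MInf
    then have "P \<noteq> \<infinity>" by (auto simp: ereal_log_def)
    with MInf l assms show ?thesis
      by (cases "q < 1") (auto simp: dim_quotient_def)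
  qed
qed

lemma eventually_ln_ratio_ge:
  assumes "0 < c" "z < 1"
  shows "\<forall>\<^sub>F \<epsilon>::real in at_right 0. 0 < \<epsilon> \<and> \<epsilon> < 1 \<and> c * \<epsilon> < 1 \<and> z * (- ln \<epsilon>) \<le> - ln (c * \<epsilon>)"
proof -
  \<comment> \<open>The inequality for \<open>z\<close> amounts to
    \<open>(1 - z) * ln \<epsilon> \<le> ln c\<close> with the worst sign
    \<open>- \<bar>ln c\<bar>\<close> on the right, which the first term of the exponent ensures.
    The second term gives \<open>c * \<epsilon> < 1\<close>, and the last keeps the bounds
    strict.\<close>
  define b where "b = exp (- \<bar>ln c\<bar> / (1 - z) - \<bar>ln c\<bar> - 1)"
  have "0 < \<epsilon> \<and> \<epsilon> < 1 \<and> c * \<epsilon> < 1 \<and> z * (- ln \<epsilon>) \<le> - ln (c * \<epsilon>)"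
    if e: "0 < \<epsilon>" "\<epsilon> < b" for \<epsilon>
  proof -
    have "ln \<epsilon> < ln b"
      using e by (subst ln_less_cancel_iff) (auto simp: b_def)
    then have l: "ln \<epsilon> < - \<bar>ln c\<bar> / (1 - z) - \<bar>ln c\<bar> - 1"
      by (simp add: b_def)
    have nn: "0 \<le> \<bar>ln c\<bar> / (1 - z)"
      using assms by simp
    have "ln \<epsilon> < 0" "ln c + ln \<epsilon> < 0"
      using l nn by auto
    then have "\<epsilon> < 1" "ln (c * \<epsilon>) < 0"
      using e assms by (auto simp: ln_mult)
    moreover have "c * \<epsilon> < 1"
      using \<open>ln (c * \<epsilon>) < 0\<close> e assms by (subst (asm) ln_less_zero_iff) auto
    moreover have "(1 - z) * ln \<epsilon> \<le> (1 - z) * (- (\<bar>ln c\<bar> / (1 - z)))"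
      using l assms by (intro mult_left_mono) auto
    then have "(1 - z) * ln \<epsilon> \<le> - \<bar>ln c\<bar>"
      using assms by simp
    then have "z * (- ln \<epsilon>) \<le> - ln (c * \<epsilon>)"
      using e assms by (simp add: ln_mult algebra_simps)
    ultimately show ?thesis
      using e by auto
  qed
  then show ?thesis
    unfolding eventually_at_right_field by (intro exI[of _ b]) (auto simp: b_def)
qed

text \<open>Since \<open>ln (c * \<epsilon>) / ln \<epsilon>\<close> tends to 1, a bound by the value at the comparable scale
  \<open>c * \<epsilon>\<close> is as good as one at the scale \<open>\<epsilon>\<close>.\<close>

lemma Limsup_Liminf_log_scale_sandwich:
  fixes A B :: "real \<Rightarrow> ereal"
  assumes c: "0 < c"
    and nn: "\<And>\<epsilon>. 0 < \<epsilon> \<Longrightarrow> 0 \<le> A \<epsilon>" "\<And>\<epsilon>. 0 < \<epsilon> \<Longrightarrow> 0 \<le> B \<epsilon>"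
    and le: "\<And>\<epsilon>. 0 < \<epsilon> \<Longrightarrow> A (c * \<epsilon>) \<le> B \<epsilon>" "\<And>\<epsilon>. 0 < \<epsilon> \<Longrightarrow> B \<epsilon> \<le> A \<epsilon>"
  shows "Limsup (at_right 0) (\<lambda>\<epsilon>. A \<epsilon> / ereal (- ln \<epsilon>)) =
      Limsup (at_right 0) (\<lambda>\<epsilon>. B \<epsilon> / ereal (- ln \<epsilon>))" (is "Limsup ?F ?a = Limsup ?F ?b")
    and "Liminf (at_right 0) (\<lambda>\<epsilon>. A \<epsilon> / ereal (- ln \<epsilon>)) =
      Liminf (at_right 0) (\<lambda>\<epsilon>. B \<epsilon> / ereal (- ln \<epsilon>))"
proof -
  \<comment> \<open>With \<open>c = 1\<close> and \<open>z = 0\<close> only the smallness of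
    \<open>\<epsilon>\<close> is left of the lemma.\<close>
  have small: "\<forall>\<^sub>F \<epsilon>::real in ?F. 0 < \<epsilon> \<and> \<epsilon> < 1"
    using eventually_ln_ratio_ge[of 1 0] by (rule eventually_mono) auto
  have ba: "\<forall>\<^sub>F \<epsilon> in ?F. ?b \<epsilon> \<le> ?a \<epsilon>"
    using small by (rule eventually_mono) (auto intro!: ereal_divide_right_mono le)
  have b0: "\<forall>\<^sub>F \<epsilon> in ?F. 0 \<le> ?b \<epsilon>"
    using small by (rule eventually_mono) (auto intro!: zero_le_divide_ereal nn)
  \<comment> \<open>Trading the denominator \<open>- ln \<epsilon>\<close> for
    \<open>- ln (c * \<epsilon>)\<close> costs a factor \<open>z\<close> that may be taken
    arbitrarily close to 1.\<close>
  have ab: "\<forall>\<^sub>F \<epsilon> in ?F. ereal z * ?a (c * \<epsilon>) \<le> ?b \<epsilon>" if z: "0 < z" "z < 1" for z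
    using eventually_ln_ratio_ge[OF c z(2)]
  proof (rule eventually_mono)
    fix \<epsilon> :: real
    assume *: "0 < \<epsilon> \<and> \<epsilon> < 1 \<and> c * \<epsilon> < 1 \<and> z * - ln \<epsilon> \<le> - ln (c * \<epsilon>)"
    then have l: "ln \<epsilon> < 0" "ln (c * \<epsilon>) < 0"
      using c by auto
    have "z / - ln (c * \<epsilon>) \<le> 1 / - ln \<epsilon>"
      using * l by (simp add: divide_simps split: if_splits) (simp add: algebra_simps)?
    then have "A (c * \<epsilon>) * ereal (z / - ln (c * \<epsilon>)) \<le> A (c * \<epsilon>) * ereal (1 / - ln \<epsilon>)"
      using * nn c by (intro ereal_mult_left_mono) auto
    then have "ereal z * ?a (c * \<epsilon>) \<le> A (c * \<epsilon>) / ereal (- ln \<epsilon>)"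
      using l nn(1)[of "c * \<epsilon>"] * c
      by (cases "A (c * \<epsilon>)") (auto simp: divide_ereal_def divide_inverse mult_ac)
    also have "\<dots> \<le> ?b \<epsilon>"
      using * l le by (intro ereal_divide_right_mono) auto
    finally show "ereal z * ?a (c * \<epsilon>) \<le> ?b \<epsilon>" .
  qed
  \<comment> \<open>Scaling by \<open>c\<close> preserves the filter of small positive numbers, so
    the quotient taken at \<open>c * \<epsilon>\<close> has the same upper and lower limits as at
    \<open>\<epsilon>\<close>.\<close>
  have filt: "filtermap (\<lambda>\<epsilon>. c * \<epsilon>) ?F = ?F"
    using filtermap_times_pos_at_right[OF c, of 0] by simp
  have inj: "inj (\<lambda>\<epsilon>::real. c * \<epsilon>)"
    using c by (auto simp: inj_def)
  have sup_c: "Limsup ?F (\<lambda>\<epsilon>. ?a (c * \<epsilon>)) = Limsup ?F ?a"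
    using Limsup_filtermap_eq[OF inj, of ?F ?a] filt by simp
  have inf_c: "Liminf ?F (\<lambda>\<epsilon>. ?a (c * \<epsilon>)) = Liminf ?F ?a"
    using Liminf_filtermap_eq[OF inj, of ?F ?a] filt by simp
  have inf0: "0 \<le> Liminf ?F ?b"
    using b0 by (rule Liminf_bounded)
  have sup0: "0 \<le> Limsup ?F ?b"
    using inf0 Liminf_le_Limsup[of ?F ?b] by (simp add: order.trans)
  \<comment> \<open>Let \<open>z\<close> tend to 1. In the extended reals this requires the right
    side to differ from \<open>-\<infinity>\<close>, which is what nonnegativity provides.\<close>
  have "Limsup ?F ?a \<le> Limsup ?F ?b"
  proof (rule ereal_le_mult_one_interval)
    fix z :: ereal assume z: "0 < z" "z < 1"
    then obtain r where r: "z = ereal r" "0 < r" "r < 1"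
      by (cases z) auto
    have "z * Limsup ?F ?a = Limsup ?F (\<lambda>\<epsilon>. ereal r * ?a (c * \<epsilon>))"
      using r sup_c by (simp add: Limsup_ereal_mult_left)
    also have "\<dots> \<le> Limsup ?F ?b"
      using ab r by (intro Limsup_mono) auto
    finally show "z * Limsup ?F ?a \<le> Limsup ?F ?b" .
  qed (use sup0 in auto)
  then show "Limsup ?F ?a = Limsup ?F ?b"
    using Limsup_mono[OF ba] by order
  have "Liminf ?F ?a \<le> Liminf ?F ?b"
  proof (rule ereal_le_mult_one_interval)
    fix z :: ereal assume z: "0 < z" "z < 1"
    then obtain r where r: "z = ereal r" "0 < r" "r < 1"
      by (cases z) auto
    have "z * Liminf ?F ?a = Liminf ?F (\<lambda>\<epsilon>. ereal r * ?a (c * \<epsilon>))"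
      using r inf_c by (simp add: Liminf_ereal_mult_left)
    also have "\<dots> \<le> Liminf ?F ?b"
      using ab r by (intro Liminf_mono) auto
    finally show "z * Liminf ?F ?a \<le> Liminf ?F ?b" .
  qed (use inf0 in auto)
  then show "Liminf ?F ?a = Liminf ?F ?b"
    using Liminf_mono[OF ba] by order
qed

section \<open>Return times\<close>

lemma return_time_ge_one: "1 \<le> return_time T A x"
  unfolding return_time_def by (auto intro!: INF_greatest simp: one_ereal_def)

lemma return_time_antimono: "A \<subseteq> B \<Longrightarrow> return_time T B x \<le> return_time T A x"
  unfolding return_time_def by (rule INF_superset_mono) auto

text \<open>Assigning \<open>\<infinity>\<close> to the times at which the orbit is outside
  \<open>A\<close> frees the index set of the infimum from \<open>x\<close> and leaves a countable
  infimum of measurable functions.\<close>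

lemma borel_measurable_return_time:
  assumes T: "T \<in> measurable M M" and A: "A \<in> sets M"
  shows "return_time T A \<in> borel_measurable M"
proof -
  have "return_time T A x = (INF m. if 0 < m \<and> (T ^^ m) x \<in> A then ereal (real m) else \<infinity>)" for x
    unfolding return_time_def
  proof (rule antisym; rule INF_greatest)
    fix m
    show "(INF m\<in>{m. 0 < m \<and> (T ^^ m) x \<in> A}. ereal (real m)) \<le>
        (if 0 < m \<and> (T ^^ m) x \<in> A then ereal (real m) else \<infinity>)"
      using INF_lower[of m "{m. 0 < m \<and> (T ^^ m) x \<in> A}" "\<lambda>m. ereal (real m)"] by simp
  next
    fix m assume "m \<in> {m. 0 < m \<and> (T ^^ m) x \<in> A}"
    then show "(INF m. if 0 < m \<and> (T ^^ m) x \<in> A then ereal (real m) else \<infinity>) \<le> ereal (real m)"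
      by (intro INF_lower2[of m]) auto
  qed
  moreover have "(\<lambda>x. INF m. if 0 < m \<and> (T ^^ m) x \<in> A then ereal (real m) else \<infinity>)
      \<in> borel_measurable M"
  proof (rule borel_measurable_INF)
    fix m
    have "(T ^^ m) \<in> measurable M M"
      using T by (rule measurable_compose_n)
    then show "(\<lambda>x. if 0 < m \<and> (T ^^ m) x \<in> A then ereal (real m) else \<infinity>) \<in> borel_measurable M"
      using A by measurable
  qed simp
  ultimately show ?thesis
    by presburger
qed

section \<open>Grid boxes\<close>

definition grid_coord :: "('n::finite) grid \<Rightarrow> real ^ 'n \<Rightarrow> real ^ 'n" where
  "grid_coord \<theta> x = snd \<theta> *v (x - fst \<theta>)"

definition box_index :: "('n::finite) grid \<Rightarrow> real \<Rightarrow> real ^ 'n \<Rightarrow> int ^ 'n" where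
  "box_index \<theta> \<epsilon> x = (\<chi> i. \<lfloor>grid_coord \<theta> x $ i / \<epsilon>\<rfloor>)"

text \<open>The translation cancels in the difference, and an orthogonal matrix preserves
  norms.\<close>

lemma norm_grid_coord_diff:
  assumes "\<theta> \<in> grids"
  shows "norm (grid_coord \<theta> x - grid_coord \<theta> y) = dist x y"
proof -
  have "orthogonal_matrix (snd \<theta>)"
    using assms by (auto simp: grids_def)
  then have "orthogonal_transformation ((*v) (snd \<theta>))"
    by (simp add: orthogonal_transformation_matrix)
  then have "norm (snd \<theta> *v (x - y)) = norm (x - y)"
    by (rule orthogonal_transformation_norm)
  then show ?thesis
    by (simp add: grid_coord_def dist_norm matrix_vector_mult_diff_distrib[symmetric])
qed

lemma grid_coord_box_center:
  assumes "\<theta> \<in> grids"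
  shows "snd \<theta> *v (x - box_center \<theta> \<epsilon> k) =
    grid_coord \<theta> x - (\<chi> i. \<epsilon> * (of_int (k $ i) + 1 / 2))"
proof -
  have "snd \<theta> ** transpose (snd \<theta>) = mat 1"
    using assms by (auto simp: grids_def orthogonal_matrix_def)
  then have "snd \<theta> *v (transpose (snd \<theta>) *v v) = v" for v
    by (simp add: matrix_vector_mul_assoc del: transpose_matrix_vector)
  then show ?thesis
    by (simp add: grid_coord_def box_center_def matrix_vector_mult_diff_distrib
        matrix_vector_right_distrib del: transpose_matrix_vector)
qed

lemma mem_grid_box_iff:
  assumes "\<theta> \<in> grids"
  shows "x \<in> grid_box \<theta> \<epsilon> k \<longleftrightarrow>
    (\<forall>i. \<epsilon> * of_int (k $ i) \<le> grid_coord \<theta> x $ i \<and> grid_coord \<theta> x $ i < \<epsilon> * (of_int (k $ i) + 1))"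
  unfolding grid_box_def cube_def mem_Collect_eq grid_coord_box_center[OF assms]
  by (intro iff_allI) (auto simp: algebra_simps)

text \<open>In units of \<open>\<epsilon>\<close>, half a side is 3/2, so around the center
  \<open>k + 1/2\<close> the box reaches from \<open>k - 1\<close> to \<open>k + 2\<close> in each
  coordinate.\<close>

lemma mem_enlarged_box_iff:
  assumes "\<theta> \<in> grids"
  shows "x \<in> enlarged_box \<theta> \<epsilon> k \<longleftrightarrow>
    (\<forall>i. \<epsilon> * (of_int (k $ i) - 1) \<le> grid_coord \<theta> x $ i \<and>
      grid_coord \<theta> x $ i < \<epsilon> * (of_int (k $ i) + 2))"
  unfolding enlarged_box_def cube_def mem_Collect_eq grid_coord_box_center[OF assms]
  by (intro iff_allI) (auto simp: algebra_simps)

text \<open>Rounding down matches half-open intervals. Both disjointness and covering of the lattice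
  partition are read off from this equivalence.\<close>

lemma mem_grid_box_iff_index:
  assumes "\<theta> \<in> grids" "0 < \<epsilon>"
  shows "x \<in> grid_box \<theta> \<epsilon> k \<longleftrightarrow> k = box_index \<theta> \<epsilon> x"
proof -
  have "(k = box_index \<theta> \<epsilon> x) \<longleftrightarrow> (\<forall>i. \<lfloor>grid_coord \<theta> x $ i / \<epsilon>\<rfloor> = k $ i)"
    by (auto simp: box_index_def vec_eq_iff)
  then show ?thesis
    using assms by (simp add: mem_grid_box_iff floor_eq_iff field_simps)
qed

text \<open>Measurability is assumed for lattice boxes of all grids and sides; this extends it to
  enlarged boxes.\<close>

lemma enlarged_box_eq_grid_box:
  assumes "\<theta> \<in> grids"
  obtains \<eta> where "\<eta> \<in> grids" "enlarged_box \<theta> \<epsilon> k = grid_box \<eta> (3 * \<epsilon>) 0"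
proof -
  define \<eta> where
    \<comment> \<open>The new origin is the lower corner of the enlarged box: its center minus half
      the diagonal.\<close>
    "\<eta> = (box_center \<theta> \<epsilon> k - transpose (snd \<theta>) *v (\<chi> i. 3 * \<epsilon> * (1 / 2)), snd \<theta>)"
  have "\<eta> \<in> grids"
    using assms by (auto simp: \<eta>_def grids_def)
  moreover have "box_center \<eta> (3 * \<epsilon>) 0 = box_center \<theta> \<epsilon> k"
    unfolding box_center_def[of \<eta>] by (simp add: \<eta>_def del: transpose_matrix_vector)
  then have "enlarged_box \<theta> \<epsilon> k = grid_box \<eta> (3 * \<epsilon>) 0"
    by (simp add: enlarged_box_def grid_box_def \<eta>_def)
  ultimately show ?thesis
    by (rule that)
qed

text \<open>Grid coordinates are isometric, so each one changes by less than
  \<open>\<epsilon>\<close> within the ball, and the enlarged box leaves a margin of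
  \<open>\<epsilon>\<close> on every side.\<close>

lemma ball_subset_enlarged_box:
  assumes \<theta>: "\<theta> \<in> grids" and "0 < \<epsilon>"
  shows "ball x \<epsilon> \<subseteq> enlarged_box \<theta> \<epsilon> (box_index \<theta> \<epsilon> x)"
proof
  fix y assume "y \<in> ball x \<epsilon>"
  then have d: "norm (grid_coord \<theta> x - grid_coord \<theta> y) < \<epsilon>"
    by (simp add: norm_grid_coord_diff[OF \<theta>])
  have x: "x \<in> grid_box \<theta> \<epsilon> (box_index \<theta> \<epsilon> x)"
    using assms by (simp add: mem_grid_box_iff_index)
  show "y \<in> enlarged_box \<theta> \<epsilon> (box_index \<theta> \<epsilon> x)"
    unfolding mem_enlarged_box_iff[OF \<theta>]
  proof
    fix i
    have "\<bar>grid_coord \<theta> x $ i - grid_coord \<theta> y $ i\<bar> < \<epsilon>"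
      using component_le_norm_cart[of "grid_coord \<theta> x - grid_coord \<theta> y" i] d by simp
    with x show "\<epsilon> * (of_int (box_index \<theta> \<epsilon> x $ i) - 1) \<le> grid_coord \<theta> y $ i \<and>
        grid_coord \<theta> y $ i < \<epsilon> * (of_int (box_index \<theta> \<epsilon> x $ i) + 2)"
      unfolding mem_grid_box_iff[OF \<theta>] by (auto simp: algebra_simps dest!: spec[of _ i])
  qed
qed

text \<open>Coordinates in \<open>[k, k + 1)\<close> and \<open>[k - 1, k + 2)\<close> differ by
  less than 2, in units of \<open>\<epsilon>\<close>. Bounding the Euclidean norm by the sum of the
  coordinates yields the crude but sufficient factor \<open>CARD('n)\<close>.\<close>

lemma enlarged_box_subset_ball:
  fixes \<theta> :: "('n::finite) grid" and \<epsilon> :: real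
  assumes \<theta>: "\<theta> \<in> grids" and "0 < \<epsilon>"
  shows "enlarged_box \<theta> \<epsilon> (box_index \<theta> \<epsilon> x) \<subseteq> ball x (2 * CARD('n) * \<epsilon>)"
proof
  fix y assume y: "y \<in> enlarged_box \<theta> \<epsilon> (box_index \<theta> \<epsilon> x)"
  have x: "x \<in> grid_box \<theta> \<epsilon> (box_index \<theta> \<epsilon> x)"
    using assms by (simp add: mem_grid_box_iff_index)
  have "\<bar>(grid_coord \<theta> x - grid_coord \<theta> y) $ i\<bar> < 2 * \<epsilon>" for i
    using x y unfolding mem_grid_box_iff[OF \<theta>] mem_enlarged_box_iff[OF \<theta>]
    by (auto simp: algebra_simps abs_less_iff dest!: spec[of _ i])
  then have "(\<Sum>i\<in>UNIV. \<bar>(grid_coord \<theta> x - grid_coord \<theta> y) $ i\<bar>) < (\<Sum>i\<in>(UNIV::'n set). 2 * \<epsilon>)"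
    by (intro sum_strict_mono) auto
  then show "y \<in> ball x (2 * CARD('n) * \<epsilon>)"
    using norm_le_l1_cart[of "grid_coord \<theta> x - grid_coord \<theta> y"]
    by (simp add: norm_grid_coord_diff[OF \<theta>])
qed

section \<open>Finiteness of the set of boxes that meet a bounded set\<close>

lemma finite_vec_nth_in:
  assumes "finite B"
  shows "finite {v :: 'a ^ 'n::finite. \<forall>i. v $ i \<in> B}"
proof (rule finite_subset)
  show "{v :: 'a ^ 'n. \<forall>i. v $ i \<in> B} \<subseteq> vec_lambda ` (\<Pi>\<^sub>E i\<in>UNIV. B)"
  proof
    fix v :: "'a ^ 'n" assume "v \<in> {v. \<forall>i. v $ i \<in> B}"
    then have "v = vec_lambda (vec_nth v)" "vec_nth v \<in> (\<Pi>\<^sub>E i\<in>UNIV. B)"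
      by auto
    then show "v \<in> vec_lambda ` (\<Pi>\<^sub>E i\<in>UNIV. B)"
      by (rule image_eqI)
  qed
  show "finite (vec_lambda ` (\<Pi>\<^sub>E i\<in>(UNIV::'n set). B))"
    using assms by (intro finite_imageI finite_PiE) auto
qed

lemma finite_box_index_image:
  fixes X :: "(real ^ 'n::finite) set"
  assumes \<theta>: "\<theta> \<in> grids" and "0 < \<epsilon>" "bounded X"
  shows "finite (box_index \<theta> \<epsilon> ` X)"
proof -
  obtain R where R: "\<And>x. x \<in> X \<Longrightarrow> dist x (fst \<theta>) \<le> R"
    using \<open>bounded X\<close> bounded_any_center[of X "fst \<theta>"] by (auto simp: dist_commute)
  have "\<lfloor>grid_coord \<theta> x $ i / \<epsilon>\<rfloor> \<in> {\<lfloor>- R / \<epsilon>\<rfloor>..\<lfloor>R / \<epsilon>\<rfloor>}" if "x \<in> X" for x i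
  proof -
    have "grid_coord \<theta> (fst \<theta>) = 0"
      by (simp add: grid_coord_def)
    then have "norm (grid_coord \<theta> x) \<le> R"
      using R[OF that] norm_grid_coord_diff[OF \<theta>, of x "fst \<theta>"] by simp
    then have "\<bar>grid_coord \<theta> x $ i\<bar> \<le> R"
      using component_le_norm_cart[of "grid_coord \<theta> x" i] by simp
    then have "- R \<le> grid_coord \<theta> x $ i" "grid_coord \<theta> x $ i \<le> R"
      by auto
    then have "- R / \<epsilon> \<le> grid_coord \<theta> x $ i / \<epsilon>" "grid_coord \<theta> x $ i / \<epsilon> \<le> R / \<epsilon>"
      using \<open>0 < \<epsilon>\<close> by (simp_all only: divide_right_mono less_imp_le)
    then show ?thesis
      by (simp only: atLeastAtMost_iff floor_mono)
  qed
  then have "box_index \<theta> \<epsilon> ` X \<subseteq> {v. \<forall>i. v $ i \<in> {\<lfloor>- R / \<epsilon>\<rfloor>..\<lfloor>R / \<epsilon>\<rfloor>}}"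
    by (auto simp: box_index_def)
  then show ?thesis
    by (rule finite_subset) (intro finite_vec_nth_in, simp)
qed

section \<open>Box sums as integrals\<close>

abbreviation box_return_time ::
    "(real ^ 'n) measure \<Rightarrow> (real ^ 'n \<Rightarrow> real ^ 'n) \<Rightarrow> ('n::finite) grid \<Rightarrow> real \<Rightarrow> real ^ 'n \<Rightarrow> ereal"
  where
  "box_return_time M T \<theta> \<epsilon> x \<equiv>
     return_time T (enlarged_box \<theta> \<epsilon> (box_index \<theta> \<epsilon> x) \<inter> space M) x"

text \<open>Boxes that miss the space contribute 0. The finitely many others partition it, and
  \<open>box_index\<close> is constant on each, so the integrands glue to a single one. A general
  \<open>\<phi>\<close> covers powers and logarithms at once.\<close>

lemma infsum_box_integrals:
  fixes M :: "(real ^ 'n::finite) measure"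
  assumes \<theta>: "\<theta> \<in> grids" and \<epsilon>: "0 < \<epsilon>" and "bounded (space M)"
    and boxes: "\<And>\<eta> r k. \<eta> \<in> grids \<Longrightarrow> r > 0 \<Longrightarrow> grid_box \<eta> r k \<inter> space M \<in> sets M"
    and T: "T \<in> measurable M M" and \<phi>: "\<phi> \<in> borel_measurable borel"
  shows "infsum (\<lambda>k. set_ext_integral M (grid_box \<theta> \<epsilon> k \<inter> space M)
      (\<lambda>x. \<phi> (return_time T (enlarged_box \<theta> \<epsilon> k \<inter> space M) x))) UNIV =
    ext_integral M (\<lambda>x. \<phi> (box_return_time M T \<theta> \<epsilon> x))"
    (is "infsum ?I UNIV = _")
proof -
  let ?K = "box_index \<theta> \<epsilon> ` space M"
  have fin: "finite ?K"
    using assms by (intro finite_box_index_image)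
  have "infsum ?I UNIV = infsum ?I ?K"
  proof (rule infsum_cong_neutral)
    fix k assume "k \<in> UNIV - ?K"
    then have "grid_box \<theta> \<epsilon> k \<inter> space M = {}"
      by (auto simp: mem_grid_box_iff_index[OF \<theta> \<epsilon>])
    then show "?I k = 0"
      by (simp add: set_ext_integral_def ext_integral_def)
  qed auto
  also have "\<dots> = (\<Sum>k\<in>?K. ?I k)"
    using fin by simp
  also have "\<dots> = ext_integral M (\<lambda>x. \<phi> (box_return_time M T \<theta> \<epsilon> x))"
  proof (rule sum_set_ext_integral[OF fin])
    fix k
    obtain \<eta> where \<eta>: "\<eta> \<in> grids" "enlarged_box \<theta> \<epsilon> k = grid_box \<eta> (3 * \<epsilon>) 0"
      using enlarged_box_eq_grid_box[OF \<theta>] .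
    then have "enlarged_box \<theta> \<epsilon> k \<inter> space M \<in> sets M"
      using boxes[of \<eta> "3 * \<epsilon>" 0] \<epsilon> by simp
    from measurable_compose[OF borel_measurable_return_time[OF T this] \<phi>]
    show "(\<lambda>x. \<phi> (return_time T (enlarged_box \<theta> \<epsilon> k \<inter> space M) x)) \<in> borel_measurable M" .
  qed (auto simp: disjoint_family_on_def mem_grid_box_iff_index[OF \<theta> \<epsilon>] intro!: boxes \<theta> \<epsilon>)
  finally show ?thesis .
qed

section \<open>Comparison of box sums with partition functions\<close>

theorem theorem2:
  fixes X :: "(real ^ 'n::finite) set"
    and M :: "(real ^ 'n) measure"
    and T :: "real ^ 'n \<Rightarrow> real ^ 'n"
    and \<theta> :: "'n grid"
    and q :: real
  assumes "compact X"
    and "prob_space M"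
    and "space M = X"
    and balls: "\<And>x r. x \<in> X \<Longrightarrow> r > 0 \<Longrightarrow> ball x r \<inter> X \<in> sets M"
    and boxes: "\<And>\<eta> r k. \<eta> \<in> grids \<Longrightarrow> r > 0 \<Longrightarrow> grid_box \<eta> r k \<inter> X \<in> sets M"
    and "measure_preserving_map M T"
    and "ergodic_map M T"
    and "\<theta> \<in> grids"
  shows "(q \<noteq> 1 \<longrightarrow>
            upper_return_dim M T q =
              Limsup (at_right 0) (\<lambda>\<epsilon>. dim_quotient q (Psi_tau M T \<theta> \<epsilon> q) \<epsilon>) \<and>
            lower_return_dim M T q =
              Liminf (at_right 0) (\<lambda>\<epsilon>. dim_quotient q (Psi_tau M T \<theta> \<epsilon> q) \<epsilon>)) \<and>
         (q = 1 \<longrightarrow>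
            upper_return_dim M T q =
              Limsup (at_right 0) (\<lambda>\<epsilon>. log_dim_quotient (Psi_log_tau M T \<theta> \<epsilon>) \<epsilon>) \<and>
            lower_return_dim M T q =
              Liminf (at_right 0) (\<lambda>\<epsilon>. log_dim_quotient (Psi_log_tau M T \<theta> \<epsilon>) \<epsilon>))"
proof -
  interpret prob_space M by fact
  define \<tau> where "\<tau> = (\<lambda>\<epsilon> x. return_time T (ball x \<epsilon> \<inter> space M) x)"
  define \<sigma> where "\<sigma> = (\<lambda>\<epsilon> x. box_return_time M T \<theta> \<epsilon> x)"
  define c where "c = real (2 * CARD('n))"
  have c: "0 < c"
    by (simp add: c_def)
  have ge1: "1 \<le> \<tau> \<epsilon> x" "1 \<le> \<sigma> \<epsilon> x" for \<epsilon> x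
    by (auto simp: \<tau>_def \<sigma>_def return_time_ge_one)
  \<comment> \<open>A larger target set is reached sooner, so the inclusions between balls and boxes
    reverse.\<close>
  have sandwich: "\<tau> (c * \<epsilon>) x \<le> \<sigma> \<epsilon> x" "\<sigma> \<epsilon> x \<le> \<tau> \<epsilon> x" if "0 < \<epsilon>" for \<epsilon> x
    using enlarged_box_subset_ball[OF \<open>\<theta> \<in> grids\<close> that, of x]
      ball_subset_enlarged_box[OF \<open>\<theta> \<in> grids\<close> that, of x]
    unfolding \<tau>_def \<sigma>_def c_def by (auto intro!: return_time_antimono)
  have T: "T \<in> measurable M M"
    using \<open>measure_preserving_map M T\<close> by (simp add: measure_preserving_map_def)
  have bnd: "bounded (space M)"
    using assms by (simp add: compact_imp_bounded)
  have sum_eq: "infsum (\<lambda>k. set_ext_integral M (grid_box \<theta> \<epsilon> k \<inter> space M)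
      (\<lambda>x. \<phi> (return_time T (enlarged_box \<theta> \<epsilon> k \<inter> space M) x))) UNIV =
      ext_integral M (\<lambda>x. \<phi> (\<sigma> \<epsilon> x))"
    if "0 < \<epsilon>" "\<phi> \<in> borel_measurable borel" for \<epsilon> \<phi>
    unfolding \<sigma>_def using that assms by (intro infsum_box_integrals bnd T) auto
  have small: "\<forall>\<^sub>F \<epsilon>::real in at_right 0. 0 < \<epsilon> \<and> \<epsilon> < 1"
    using eventually_ln_ratio_ge[of 1 0] by (rule eventually_mono) auto
  show ?thesis
  proof (cases "q = 1")
    case True
    \<comment> \<open>The minus sign makes the integrand the logarithm of the return time, hence
      nonnegative and increasing in it, infinite values included.\<close>
    define J where "J f = ext_integral M (\<lambda>x. - ereal_log (inverse (f x)))" for f :: "real ^ 'n \<Rightarrow> ereal"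
    have nonneg: "ereal_log (inverse (f x)) \<le> 0" if "1 \<le> f x" for f :: "real ^ 'n \<Rightarrow> ereal" and x
      using that by (rule ereal_log_inverse_nonpos)
    have mono: "J f \<le> J g" if "\<And>x. 1 \<le> f x" "\<And>x. f x \<le> g x" for f g
      unfolding J_def using nonneg[of f] that
      by (intro ext_integral_mono_nonneg) (auto intro!: ereal_log_inverse_antimono)
    have J0: "0 \<le> J f" if "\<And>x. 1 \<le> f x" for f
      unfolding J_def using nonneg that by (subst ext_integral_nonneg_eq) auto
    have quot: "log_dim_quotient (ext_integral M (\<lambda>x. ereal_log (inverse (f x)))) \<epsilon> = J f / ereal (- ln \<epsilon>)"
      if "\<And>x. 1 \<le> f x" "0 < \<epsilon>" "\<epsilon> < 1" for f \<epsilon>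
      unfolding J_def using nonneg that by (intro log_dim_quotient_ext_integral_nonpos) auto
    have G: "\<forall>\<^sub>F \<epsilon> in at_right 0. log_dim_quotient (Gamma_log_tau M T \<epsilon>) \<epsilon> = J (\<tau> \<epsilon>) / ereal (- ln \<epsilon>)"
      using small
    proof (rule eventually_mono)
      fix \<epsilon> :: real assume "0 < \<epsilon> \<and> \<epsilon> < 1"
      then show "log_dim_quotient (Gamma_log_tau M T \<epsilon>) \<epsilon> = J (\<tau> \<epsilon>) / ereal (- ln \<epsilon>)"
        using quot[of "\<tau> \<epsilon>" \<epsilon>] ge1 by (simp add: Gamma_log_tau_def \<tau>_def)
    qed
    have P: "\<forall>\<^sub>F \<epsilon> in at_right 0. log_dim_quotient (Psi_log_tau M T \<theta> \<epsilon>) \<epsilon> = J (\<sigma> \<epsilon>) / ereal (- ln \<epsilon>)"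
      using small
    proof (rule eventually_mono)
      fix \<epsilon> :: real assume *: "0 < \<epsilon> \<and> \<epsilon> < 1"
      have "(\<lambda>x. ereal_log (inverse x)) \<in> borel_measurable borel"
        by (rule measurable_compose[OF _ borel_measurable_ereal_log]) measurable
      with * have "Psi_log_tau M T \<theta> \<epsilon> = ext_integral M (\<lambda>x. ereal_log (inverse (\<sigma> \<epsilon> x)))"
        unfolding Psi_log_tau_def using sum_eq[of \<epsilon> "\<lambda>x. ereal_log (inverse x)"] by simp
      then show "log_dim_quotient (Psi_log_tau M T \<theta> \<epsilon>) \<epsilon> = J (\<sigma> \<epsilon>) / ereal (- ln \<epsilon>)"
        using * quot[of "\<sigma> \<epsilon>" \<epsilon>] ge1 by simp
    qed
    note lim = Limsup_Liminf_log_scale_sandwich[where c = c and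
        A = "\<lambda>\<epsilon>. J (\<tau> \<epsilon>)" and B = "\<lambda>\<epsilon>. J (\<sigma> \<epsilon>)",
        OF c J0[of "\<tau> _", OF ge1(1)] J0[of "\<sigma> _", OF ge1(2)]
          mono[OF ge1(1) sandwich(1)] mono[OF ge1(2) sandwich(2)]]
    show ?thesis
      using True lim
      by (simp add: upper_return_dim_def lower_return_dim_def
          Limsup_eq[OF G] Liminf_eq[OF G] Limsup_eq[OF P] Liminf_eq[OF P])
  next
    case False
    define J where "J f = ext_integral M (\<lambda>x. ereal_powr (f x) (1 - q))" for f :: "real ^ 'n \<Rightarrow> ereal"
    \<comment> \<open>For \<open>q < 1\<close> the integral \<open>J\<close> is at least 1 and
      increasing in the return time; for \<open>q > 1\<close> it is at most 1 and decreasing. The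
      sign of \<open>1 / (1 - q)\<close> compensates, so \<open>L\<close> is nonnegative and
      increasing in both cases.\<close>
    define L where "L f = ereal (1 / (1 - q)) * ereal_log (J f)" for f
    \<comment> \<open>The space has total mass 1, so comparing the integrand with the constant 1
      bounds \<open>J\<close> by 1.\<close>
    have one: "J f \<le> 1" if "1 < q" "\<And>x. 1 \<le> f x" for f
      using ext_integral_mono_nonneg[of M "\<lambda>x. ereal_powr (f x) (1 - q)" "\<lambda>_. 1"] that
      by (simp add: J_def ext_integral_const_one ereal_powr_nonneg ereal_powr_le_one)
    have one': "1 \<le> J f" if "q < 1" "\<And>x. 1 \<le> f x" for f
      using ext_integral_mono_nonneg[of M "\<lambda>_. 1" "\<lambda>x. ereal_powr (f x) (1 - q)"] that
      by (simp add: J_def ext_integral_const_one ereal_powr_ge_one)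
    have L0: "0 \<le> L f" if "\<And>x. 1 \<le> f x" for f
    proof (cases "q < 1")
      case True
      then show ?thesis
        using ereal_log_nonneg[OF one'[of f]] that by (simp add: L_def)
    next
      case False
      then have "1 < q" using \<open>q \<noteq> 1\<close> by simp
      then show ?thesis
        using ereal_log_nonpos[OF one[of f]] that by (auto simp: L_def ereal_zero_le_0_iff)
    qed
    have mono: "L f \<le> L g" if "\<And>x. 1 \<le> f x" "\<And>x. f x \<le> g x" for f g
    proof (cases "q < 1")
      case True
      then have "J f \<le> J g"
        unfolding J_def using that
        by (intro ext_integral_mono_nonneg) (auto intro: ereal_powr_mono ereal_powr_nonneg)
      then show ?thesis
        unfolding L_def using True by (intro ereal_mult_left_mono ereal_log_mono) auto
    next
      case False
      then have q: "1 < q" using \<open>q \<noteq> 1\<close> by simp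
      then have "J g \<le> J f"
        unfolding J_def using that
        by (intro ext_integral_mono_nonneg) (auto intro: ereal_powr_antimono ereal_powr_nonneg)
      then have "ereal (1 / (q - 1)) * ereal_log (J g) \<le> ereal (1 / (q - 1)) * ereal_log (J f)"
        using q by (intro ereal_mult_left_mono ereal_log_mono) auto
      moreover have "ereal (1 / (1 - q)) = - ereal (1 / (q - 1))"
        using q by (simp add: field_simps)
      ultimately show ?thesis
        by (simp only: L_def ereal_mult_minus_left ereal_minus_le_minus)
    qed
    \<comment> \<open>For \<open>q > 1\<close> the bound \<open>J f \<le> 1\<close> rules out the
      value \<open>\<infinity>\<close>, so the convention for non-summable integrands takes effect
      only for \<open>q < 1\<close>, where it agrees with the formula.\<close>
    have quot: "dim_quotient q (J f) \<epsilon> = L f / ereal (- ln \<epsilon>)"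
      if "\<And>x. 1 \<le> f x" "0 < \<epsilon>" "\<epsilon> < 1" for f \<epsilon>
      unfolding L_def using that one[of f] \<open>q \<noteq> 1\<close>
      by (intro dim_quotient_eq) (auto simp: not_less_iff_gr_or_eq)
    have G: "\<forall>\<^sub>F \<epsilon> in at_right 0. dim_quotient q (Gamma_tau M T \<epsilon> q) \<epsilon> = L (\<tau> \<epsilon>) / ereal (- ln \<epsilon>)"
      using small
    proof (rule eventually_mono)
      fix \<epsilon> :: real assume "0 < \<epsilon> \<and> \<epsilon> < 1"
      then show "dim_quotient q (Gamma_tau M T \<epsilon> q) \<epsilon> = L (\<tau> \<epsilon>) / ereal (- ln \<epsilon>)"
        using quot[of "\<tau> \<epsilon>" \<epsilon>] ge1 by (simp add: Gamma_tau_def \<tau>_def J_def)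
    qed
    have P: "\<forall>\<^sub>F \<epsilon> in at_right 0. dim_quotient q (Psi_tau M T \<theta> \<epsilon> q) \<epsilon> = L (\<sigma> \<epsilon>) / ereal (- ln \<epsilon>)"
      using small
    proof (rule eventually_mono)
      fix \<epsilon> :: real assume *: "0 < \<epsilon> \<and> \<epsilon> < 1"
      then have "Psi_tau M T \<theta> \<epsilon> q = J (\<sigma> \<epsilon>)"
        unfolding Psi_tau_def J_def
        using sum_eq[of \<epsilon> "\<lambda>x. ereal_powr x (1 - q)"] borel_measurable_ereal_powr by simp
      then show "dim_quotient q (Psi_tau M T \<theta> \<epsilon> q) \<epsilon> = L (\<sigma> \<epsilon>) / ereal (- ln \<epsilon>)"
        using * quot[of "\<sigma> \<epsilon>" \<epsilon>] ge1 by simp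
    qed
    \<comment> \<open>The box quantity at scale \<open>\<epsilon>\<close> is enclosed by the ball
      quantities at the scales \<open>c * \<epsilon>\<close> and \<open>\<epsilon>\<close>.\<close>
    note lim = Limsup_Liminf_log_scale_sandwich[where c = c and
        A = "\<lambda>\<epsilon>. L (\<tau> \<epsilon>)" and B = "\<lambda>\<epsilon>. L (\<sigma> \<epsilon>)",
        OF c L0[of "\<tau> _", OF ge1(1)] L0[of "\<sigma> _", OF ge1(2)]
          mono[OF ge1(1) sandwich(1)] mono[OF ge1(2) sandwich(2)]]
    show ?thesis
      using False lim
      by (simp add: upper_return_dim_def lower_return_dim_def
          Limsup_eq[OF G] Liminf_eq[OF G] Limsup_eq[OF P] Liminf_eq[OF P])
  qed
qed

end
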